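(* Let $V$ be an object of $\mathcal{W}$, and assume that the action of $Z(\mathfrak{g})\cong\mathbb{C}[z]$ on $V$ is locally finite. For $\xi\in\mathbb{C}\cong \mathrm{Hom}_{\mathrm{alg}}(Z(\mathfrak{g}),\mathbb{C})$, let $V_\xi=\{v\in V \mid (z-\xi)^kv=0 \text{ for } k\gg 0\}$. Then each $V_\xi$ is a $\mathfrak{g}$-module, and $$V=\bigoplus_{\xi\in\mathbb{C}}V_\xi.$$ Moreover, if $V$ is finitely generated, then $V_\xi$ is finitely generated and has a finite filtration $0=V_{\xi,0}\subseteq V_{\xi,1}\subseteq V_{\xi,2}\subseteq\cdots\subseteq V_{\xi,k}=V_\xi$ such that $z$ acts by $\xi$ on $V_{\xi,i+1}/V_{\xi,i}$ for each $0\le i<k$, where $V_{\xi,i}=\{v\in V_\xi \mid (z-\xi)^iv=0\}$.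
   Context: $\mathfrak{g}$ is the Virasoro Lie algebra over $\mathbb{C}$, with basis $\{z, d_k \mid k \in \mathbb{Z}\}$ and bracket $[d_k,d_j]=(k-j)d_{k+j}+\delta_{j,-k}\frac{k^3-k}{12}z$, $[z,d_k]=0$; $\mathfrak{n}^+=\mathrm{span}_{\mathbb{C}}\{d_k \mid k>0\}$. $Z(\mathfrak{g})$ denotes the center of $U(\mathfrak{g})$; it is known that $Z(\mathfrak{g})=\mathbb{C}[z]$. $\mathcal{W}$ is the full subcategory of $\mathfrak{g}$-modules on which $\mathfrak{n}^+$ acts locally finitely. The action of $Z(\mathfrak{g})$ on $V$ is locally finite if $\dim_{\mathbb{C}} Z(\mathfrak{g})v<\infty$ for all $v\in V$. *)

theory Defs
  imports Complex_Main "HOL-Library.Poly_Mapping"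
begin

section \<open>The Virasoro algebra\<close>

datatype vir_gen = GenZ | GenD int

text \<open>An element of \<open>\<gg>\<close> is a finitely supported family of coefficients on the basis.\<close>

type_synonym vir = "vir_gen \<Rightarrow>\<^sub>0 complex"

definition vz :: vir where
  "vz = Poly_Mapping.single GenZ 1"

definition vd :: "int \<Rightarrow> vir" where
  "vd k = Poly_Mapping.single (GenD k) 1"

definition vir_scale :: "complex \<Rightarrow> vir \<Rightarrow> vir" where
  "vir_scale c x = Poly_Mapping.map ((*) c) x"

fun gen_bracket :: "vir_gen \<Rightarrow> vir_gen \<Rightarrow> vir" where
  "gen_bracket (GenD k) (GenD j) =
     vir_scale (of_int (k - j)) (vd (k + j))
     + (if j = - k then vir_scale (of_int (k ^ 3 - k) / 12) vz else 0)"
| "gen_bracket GenZ _ = 0"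
| "gen_bracket _ GenZ = 0"

definition vir_bracket :: "vir \<Rightarrow> vir \<Rightarrow> vir" where
  "vir_bracket x y =
     (\<Sum>a\<in>Poly_Mapping.keys x. \<Sum>b\<in>Poly_Mapping.keys y.
        vir_scale (Poly_Mapping.lookup x a * Poly_Mapping.lookup y b) (gen_bracket a b))"

lemma lookup_vir_scale [simp]:
  "Poly_Mapping.lookup (vir_scale c x) a = c * Poly_Mapping.lookup x a"
  by (simp add: vir_scale_def Poly_Mapping.map.rep_eq when_def)

interpretation vir: vector_space vir_scale
  by unfold_locales (auto intro!: poly_mapping_eqI simp: lookup_add algebra_simps)

lemma poly_mapping_sum_induct [case_names zero single add]:
  fixes x :: "'a \<Rightarrow>\<^sub>0 'b::comm_monoid_add"
  assumes "P 0" "\<And>k c. P (Poly_Mapping.single k c)" "\<And>a b. P a \<Longrightarrow> P b \<Longrightarrow> P (a + b)"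
  shows "P x"
proof (induction x rule: update_induct)
  case const
  then show ?case by (simp add: assms(1))
next
  case (update f a b)
  have "Poly_Mapping.update a b f = f + Poly_Mapping.single a b"
    using update(1) by (intro poly_mapping_eqI)
      (auto simp: lookup_update lookup_add lookup_single in_keys_iff)
  then show ?case using assms(2,3) update by simp
qed

lemma vir_bracket_single [simp]:
  "vir_bracket (Poly_Mapping.single a c) (Poly_Mapping.single b e) =
     vir_scale (c * e) (gen_bracket a b)"
  by (auto simp: vir_bracket_def)

lemma vir_bracket_add_left: "vir_bracket (x + x') y = vir_bracket x y + vir_bracket x' y"
  unfolding vir_bracket_def
  by (rule setsum_keys_plus_distrib)
    (simp_all add: vir.scale_left_distrib sum.distrib distrib_right)

lemma vir_bracket_add_right: "vir_bracket x (y + y') = vir_bracket x y + vir_bracket x y'"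
  unfolding vir_bracket_def sum.distrib [symmetric]
  by (intro sum.cong refl setsum_keys_plus_distrib)
    (simp_all add: vir.scale_left_distrib distrib_left)

lemma vir_bracket_zero [simp]: "vir_bracket 0 y = 0" "vir_bracket x 0 = 0"
  by (simp_all add: vir_bracket_def)

lemma vir_scale_single: "vir_scale c (Poly_Mapping.single a e) = Poly_Mapping.single a (c * e)"
  by (rule poly_mapping_eqI) (simp add: lookup_single when_def)

lemma vir_bracket_scale_left: "vir_bracket (vir_scale c x) y = vir_scale c (vir_bracket x y)"
proof (induction x rule: poly_mapping_sum_induct)
  case (single k e)
  show ?case
    by (induction y rule: poly_mapping_sum_induct)
      (simp_all add: vir_scale_single vir_bracket_add_right vir.scale_right_distrib mult.assoc)
qed (simp_all add: vir.scale_right_distrib vir_bracket_add_left)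

lemma vir_bracket_scale_right: "vir_bracket x (vir_scale c y) = vir_scale c (vir_bracket x y)"
proof (induction x rule: poly_mapping_sum_induct)
  case (single k e)
  show ?case
    by (induction y rule: poly_mapping_sum_induct)
      (simp_all add: vir_scale_single vir_bracket_add_right vir.scale_right_distrib
        mult.left_commute)
qed (simp_all add: vir.scale_right_distrib vir_bracket_add_left)

lemma vir_bracket_vd:
  "vir_bracket (vd k) (vd j) =
     vir_scale (of_int (k - j)) (vd (k + j))
     + (if j = - k then vir_scale (of_int (k ^ 3 - k) / 12) vz else 0)"
  using vir_bracket_single[of "GenD k" 1 "GenD j" 1] by (simp add: vd_def)

lemma vir_bracket_vz [simp]: "vir_bracket vz x = 0" "vir_bracket x vz = 0"
proof -
  show "vir_bracket vz x = 0"
    by (induction x rule: poly_mapping_sum_induct) (simp_all add: vz_def vir_bracket_add_right)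
  have "gen_bracket a GenZ = 0" for a by (cases a) simp_all
  then show "vir_bracket x vz = 0"
    by (induction x rule: poly_mapping_sum_induct) (simp_all add: vz_def vir_bracket_add_left)
qed

lemma vir_bracket_antisym: "vir_bracket x y = - vir_bracket y x"
proof (induction x rule: poly_mapping_sum_induct)
  case (single a c)
  have *: "gen_bracket a b = - gen_bracket b a" for a b
    by (cases a; cases b)
      (auto intro!: poly_mapping_eqI simp: lookup_add add.commute field_simps power3_eq_cube)
  show ?case
  proof (induction y rule: poly_mapping_sum_induct)
    case (single b e)
    show ?case
      by (simp add: *[of a b] mult.commute)
  qed (simp_all add: vir_bracket_add_left vir_bracket_add_right)
qed (simp_all add: vir_bracket_add_left vir_bracket_add_right)

lemma vir_jacobi:
  "vir_bracket x (vir_bracket y w) + vir_bracket y (vir_bracket w x)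
     + vir_bracket w (vir_bracket x y) = 0" (is "?J x y w = 0")
proof -
  have add: "?J (x + x') y w = ?J x y w + ?J x' y w"
    "?J x (y + y') w = ?J x y w + ?J x y' w"
    "?J x y (w + w') = ?J x y w + ?J x y w'" for x x' y y' w w'
    by (simp_all add: vir_bracket_add_left vir_bracket_add_right)
  have scale: "?J (vir_scale c x) y w = vir_scale c (?J x y w)"
    "?J x (vir_scale c y) w = vir_scale c (?J x y w)"
    "?J x y (vir_scale c w) = vir_scale c (?J x y w)" for c x y w
    by (simp_all add: vir_bracket_scale_left vir_bracket_scale_right vir.scale_right_distrib)
  have single: "Poly_Mapping.single a c = vir_scale c (Poly_Mapping.single a 1)"
    for a :: vir_gen and c
    by (simp add: vir_scale_single)
  have basis: "?J (vd k) (vd j) (vd l) = 0" for k j l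
  proof (rule poly_mapping_eqI)
    have coeff: "Poly_Mapping.lookup (vir_bracket (vd k) (vir_bracket (vd j) (vd l))) u =
      (case u of
         GenD m \<Rightarrow> of_int (if m = k + j + l then (j - l) * (k - j - l) else 0)
       | GenZ \<Rightarrow> of_int (if k + j + l = 0 then (j - l) * (k ^ 3 - k) else 0) / 12)" for k j l u
    proof -
      have "vir_bracket (vd k) (vir_bracket (vd j) (vd l)) =
          vir_scale (of_int (j - l)) (vir_bracket (vd k) (vd (j + l)))"
        unfolding vir_bracket_vd[of j l] vir_bracket_add_right vir_bracket_scale_right
        by (simp add: vir_bracket_scale_right)
      moreover have "j + l = - k \<longleftrightarrow> k + j + l = 0" "k + (j + l) = k + j + l"
        "k - (j + l) = k - j - l" by auto
      ultimately show ?thesis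
        by (auto simp: vir_bracket_vd lookup_add vd_def vz_def lookup_single when_def
            simp del: of_int_add of_int_diff split: vir_gen.split)
    qed
    fix u
    show "Poly_Mapping.lookup (?J (vd k) (vd j) (vd l)) u = Poly_Mapping.lookup 0 u"
    proof (cases u)
      case GenZ
      show ?thesis
      proof (cases "k + j + l = 0")
        case True
        then have l: "l = - k - j" by simp
        have "(j - l) * (k ^ 3 - k) + (l - k) * (j ^ 3 - j) + (k - j) * (l ^ 3 - l) = (0::int)"
          unfolding l by (simp add: algebra_simps power3_eq_cube)
        then have "of_int ((j - l) * (k ^ 3 - k) + (l - k) * (j ^ 3 - j)
            + (k - j) * (l ^ 3 - l)) = (0::complex)"
          by (simp only: of_int_0)
        moreover have "k + j + l = 0" "j + l + k = 0" "l + k + j = 0" using True by simp_all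
        ultimately show ?thesis
          unfolding lookup_add coeff GenZ
          by (simp only: refl if_True vir_gen.case lookup_zero add_divide_distrib [symmetric]
              of_int_add div_0)
      next
        case False
        then have "k + j + l \<noteq> 0" "j + l + k \<noteq> 0" "l + k + j \<noteq> 0" by simp_all
        then show ?thesis
          unfolding lookup_add coeff GenZ by simp
      qed
    next
      case (GenD m)
      show ?thesis
      proof (cases "m = k + j + l")
        case True
        then have "m = k + j + l" "m = j + l + k" "m = l + k + j" by simp_all
        moreover have "(j - l) * (k - j - l) + (l - k) * (j - l - k) + (k - j) * (l - k - j)
            = (0::int)"
          by (simp add: algebra_simps)
        then have "of_int ((j - l) * (k - j - l) + (l - k) * (j - l - k)
            + (k - j) * (l - k - j)) = (0::complex)"
          by (simp only: of_int_0)
        ultimately show ?thesis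
          unfolding lookup_add coeff GenD
          by (simp only: refl if_True vir_gen.case lookup_zero of_int_add)
      next
        case False
        then have "m \<noteq> k + j + l" "m \<noteq> j + l + k" "m \<noteq> l + k + j" by simp_all
        then show ?thesis
          unfolding lookup_add coeff GenD by simp
      qed
    qed
  qed
  have gens: "?J (Poly_Mapping.single a 1) (Poly_Mapping.single b 1) (Poly_Mapping.single c 1) = 0"
    for a b c
    using basis by (cases a; cases b; cases c)
      (simp_all only: vz_def [symmetric] vd_def [symmetric] vir_bracket_vz vir_bracket_zero
        add_0_left add_0_right)
  have "?J (Poly_Mapping.single a c) (Poly_Mapping.single b c') (Poly_Mapping.single d c'') = 0"
    for a b d c c' c''
    unfolding single[of a c] single[of b c'] single[of d c''] scale gens
    by simp
  then have "?J (Poly_Mapping.single a c) (Poly_Mapping.single b c') w = 0" for a b c c' w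
    by (induction w rule: poly_mapping_sum_induct) (simp_all only: add, simp_all)
  then have "?J (Poly_Mapping.single a c) y w = 0" for a c y w
    by (induction y rule: poly_mapping_sum_induct) (simp_all only: add, simp_all)
  then show ?thesis
    by (induction x rule: poly_mapping_sum_induct) (simp_all only: add, simp_all)
qed

definition n_plus :: "vir set" where
  "n_plus = vir.span {vd k | k. k > 0}"


section \<open>The universal enveloping algebra\<close>

text \<open>The free monoid on \<open>'a\<close>; with it \<open>'a word \<Rightarrow>\<^sub>0 complex\<close>, under the convolution product of
  \<^theory>\<open>HOL-Library.Poly_Mapping\<close>, is the free associative algebra on the set \<open>'a\<close>.\<close>

datatype 'a word = Word (letters: "'a list")

instantiation word :: (type) monoid_add
begin

definition "0 = Word []"
definition "u + w = Word (letters u @ letters w)"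

instance
  by standard (simp_all add: zero_word_def plus_word_def)

end

type_synonym free_vir = "vir word \<Rightarrow>\<^sub>0 complex"

definition fgen :: "vir \<Rightarrow> free_vir" where
  "fgen x = Poly_Mapping.single (Word [x]) 1"

definition fconst :: "complex \<Rightarrow> free_vir" where
  "fconst c = Poly_Mapping.single 0 c"

text \<open>The free algebra is taken on the underlying set of \<open>\<gg>\<close>, so the two-sided ideal contains the
  relations making \<^const>\<open>fgen\<close> linear (whose quotient alone is the tensor algebra) besides
  the commutator relations.\<close>

inductive_set env_ideal :: "free_vir set" where
  rel_add: "fgen (x + y) - fgen x - fgen y \<in> env_ideal"
| rel_scale: "fgen (vir_scale c x) - fconst c * fgen x \<in> env_ideal"
| rel_bracket: "fgen x * fgen y - fgen y * fgen x - fgen (vir_bracket x y) \<in> env_ideal"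
| zero: "0 \<in> env_ideal"
| add: "a \<in> env_ideal \<Longrightarrow> b \<in> env_ideal \<Longrightarrow> a + b \<in> env_ideal"
| mult_left: "a \<in> env_ideal \<Longrightarrow> t * a \<in> env_ideal"
| mult_right: "a \<in> env_ideal \<Longrightarrow> a * t \<in> env_ideal"

lemma env_ideal_uminus: "a \<in> env_ideal \<Longrightarrow> - a \<in> env_ideal"
  using env_ideal.mult_left[of a "- 1"] by simp

lemma env_ideal_diff: "a \<in> env_ideal \<Longrightarrow> b \<in> env_ideal \<Longrightarrow> a - b \<in> env_ideal"
  using env_ideal.add[of a "- b"] env_ideal_uminus[of b] by simp

locale vir_module = vector_space scale
  for scale :: "complex \<Rightarrow> 'v::ab_group_add \<Rightarrow> 'v" +
  fixes act :: "vir \<Rightarrow> 'v \<Rightarrow> 'v"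
  assumes act_add_left: "act (x + y) v = act x v + act y v"
    and act_scale_left: "act (vir_scale c x) v = scale c (act x v)"
    and act_add_right: "act x (v + w) = act x v + act x w"
    and act_scale_right: "act x (scale c v) = scale c (act x v)"
    and act_bracket: "act (vir_bracket x y) v = act x (act y v) - act y (act x v)"

definition free_act ::
  "(complex \<Rightarrow> 'v \<Rightarrow> 'v) \<Rightarrow> (vir \<Rightarrow> 'v \<Rightarrow> 'v) \<Rightarrow> free_vir \<Rightarrow> 'v \<Rightarrow> 'v::ab_group_add" where
  "free_act scale act t v =
     (\<Sum>w\<in>Poly_Mapping.keys t. scale (Poly_Mapping.lookup t w) (foldr act (letters w) v))"

context vir_module
begin

lemma act_zero_right: "act x 0 = 0"
  using act_scale_right[of x 0 0] by simp

lemma act_uminus_right: "act x (- v) = - act x v"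
  using act_scale_right[of x "- 1" v] by simp

lemma foldr_act_add: "foldr act xs (v + w) = foldr act xs v + foldr act xs w"
  by (induction xs) (simp_all add: act_add_right)

lemma foldr_act_scale: "foldr act xs (scale c v) = scale c (foldr act xs v)"
  by (induction xs) (simp_all add: act_scale_right)

lemma free_act_zero: "free_act scale act 0 v = 0"
  by (simp add: free_act_def)

lemma free_act_single:
  "free_act scale act (Poly_Mapping.single w c) v = scale c (foldr act (letters w) v)"
  by (simp add: free_act_def)

lemma free_act_add: "free_act scale act (s + t) v = free_act scale act s v + free_act scale act t v"
  unfolding free_act_def
  by (rule setsum_keys_plus_distrib) (simp_all add: scale_left_distrib)

lemma free_act_add_right:
  "free_act scale act t (v + w) = free_act scale act t v + free_act scale act t w"
  by (simp add: free_act_def foldr_act_add scale_right_distrib sum.distrib)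

lemma free_act_scale_right: "free_act scale act t (scale c v) = scale c (free_act scale act t v)"
  by (simp add: free_act_def foldr_act_scale scale_sum_right mult.commute)

lemma free_act_mult: "free_act scale act (s * t) v = free_act scale act s (free_act scale act t v)"
proof (induction s rule: poly_mapping_sum_induct)
  case (single a c)
  show ?case
  proof (induction t rule: poly_mapping_sum_induct)
    case (single b e)
    show ?case
      by (simp add: mult_single free_act_single plus_word_def foldr_act_scale)
  next
    case zero
    show ?case using free_act_scale_right[of _ 0 0] by (simp add: free_act_zero)
  qed (simp add: distrib_left free_act_add free_act_add_right)
qed (simp_all add: free_act_zero distrib_right free_act_add)

lemma free_act_uminus: "free_act scale act (- t) v = - free_act scale act t v"
  using free_act_add[of t "- t" v] by (simp add: free_act_zero minus_unique)

lemma free_act_diff: "free_act scale act (s - t) v = free_act scale act s v - free_act scale act t v"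
  using free_act_add[of s "- t" v] by (simp add: free_act_uminus)

lemma free_act_ideal: "t \<in> env_ideal \<Longrightarrow> free_act scale act t v = 0"
proof (induction arbitrary: v rule: env_ideal.induct)
  case (mult_left a t)
  then show ?case using free_act_scale_right[of t 0 0] by (simp add: free_act_mult)
qed (simp_all add: free_act_zero free_act_add free_act_diff free_act_mult fgen_def fconst_def
      free_act_single zero_word_def act_add_left act_scale_left act_bracket)

end

definition env_rel :: "free_vir \<Rightarrow> free_vir \<Rightarrow> bool" where
  "env_rel a b \<longleftrightarrow> a - b \<in> env_ideal"

lemma equivp_env_rel: "equivp env_rel"
proof (rule equivpI)
  show "reflp env_rel" by (simp add: reflp_def env_rel_def env_ideal.zero)
  show "symp env_rel"
    by (rule sympI) (use env_ideal_uminus in \<open>fastforce simp: env_rel_def\<close>)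
  show "transp env_rel"
    by (rule transpI) (use env_ideal.add in \<open>fastforce simp: env_rel_def\<close>)
qed

quotient_type env = free_vir / env_rel
  by (rule equivp_env_rel)

instantiation env :: ring_1
begin

lift_definition zero_env :: env is 0 .
lift_definition one_env :: env is 1 .
lift_definition plus_env :: "env \<Rightarrow> env \<Rightarrow> env" is "(+)"
  unfolding env_rel_def using env_ideal.add by (metis add_diff_add)
lift_definition uminus_env :: "env \<Rightarrow> env" is uminus
  unfolding env_rel_def using env_ideal_uminus by (metis minus_diff_minus)
lift_definition minus_env :: "env \<Rightarrow> env \<Rightarrow> env" is "(-)"
proof -
  fix a a' b b' assume "env_rel a a'" "env_rel b b'"
  then have "(a - a') - (b - b') \<in> env_ideal"
    unfolding env_rel_def by (rule env_ideal_diff)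
  then show "env_rel (a - b) (a' - b')" by (simp add: env_rel_def algebra_simps)
qed
lift_definition times_env :: "env \<Rightarrow> env \<Rightarrow> env" is "(*)"
proof -
  fix a a' b b' assume "env_rel a a'" "env_rel b b'"
  then have "(a - a') * b + a' * (b - b') \<in> env_ideal"
    unfolding env_rel_def by (intro env_ideal.intros)
  then show "env_rel (a * b) (a' * b')" by (simp add: env_rel_def algebra_simps)
qed

instance
proof
  interpret triv: vir_module "(*)" "\<lambda>_ _. 0 :: complex"
    by unfold_locales (simp_all add: algebra_simps)
  have "free_act (*) (\<lambda>_ _. 0) 1 (1::complex) = 1"
    by (simp add: triv.free_act_single zero_word_def flip: single_one)
  then have "(1::free_vir) \<notin> env_ideal"
    using triv.free_act_ideal[of 1 1] by auto
  then show "(0::env) \<noteq> 1"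
    by transfer (use env_ideal_uminus[of "- 1"] in \<open>auto simp: env_rel_def\<close>)
qed (transfer; simp add: env_rel_def env_ideal.zero algebra_simps)+

end

lift_definition env_gen :: "vir \<Rightarrow> env" is fgen .

lift_definition env_const :: "complex \<Rightarrow> env" is fconst .

definition center :: "env set" where
  "center = {u. \<forall>w. u * w = w * u}"

inductive_set subalgebra_generated :: "env set \<Rightarrow> env set" for S where
  const: "env_const c \<in> subalgebra_generated S"
| gen: "s \<in> S \<Longrightarrow> s \<in> subalgebra_generated S"
| add: "u \<in> subalgebra_generated S \<Longrightarrow> w \<in> subalgebra_generated S \<Longrightarrow>
    u + w \<in> subalgebra_generated S"
| mult: "u \<in> subalgebra_generated S \<Longrightarrow> w \<in> subalgebra_generated S \<Longrightarrow>
    u * w \<in> subalgebra_generated S"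

text \<open>By Poincare-Birkhoff-Witt this subalgebra of \<open>U(\<gg>)\<close> is \<open>U(\<nn>\<^sup>+)\<close>.\<close>

definition U_n_plus :: "env set" where
  "U_n_plus = subalgebra_generated (env_gen ` n_plus)"


text \<open>The choice of representative is immaterial for a module; see \<open>env_act_abs\<close> below.\<close>

definition env_act ::
  "(complex \<Rightarrow> 'v \<Rightarrow> 'v) \<Rightarrow> (vir \<Rightarrow> 'v \<Rightarrow> 'v) \<Rightarrow> env \<Rightarrow> 'v \<Rightarrow> 'v::ab_group_add" where
  "env_act scale act u v = free_act scale act (rep_env u) v"

context vir_module
begin

lemma env_act_abs: "env_act scale act (abs_env t) v = free_act scale act t v"
proof -
  have "env_rel (rep_env (abs_env t)) t"
    by (rule Quotient_rep_abs[OF Quotient_env]) (simp add: env_rel_def env_ideal.zero)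
  then show ?thesis
    using free_act_ideal[of "rep_env (abs_env t) - t" v]
    by (simp add: env_act_def env_rel_def free_act_diff)
qed

lemma env_act_one: "env_act scale act 1 v = v"
  by (simp add: one_env_def env_act_abs free_act_single zero_word_def flip: single_one)

lemma env_act_gen: "env_act scale act (env_gen x) v = act x v"
  by (simp add: env_gen_def env_act_abs fgen_def free_act_single)

lemma env_act_const: "env_act scale act (env_const c) v = scale c v"
  by (simp add: env_const_def env_act_abs fconst_def free_act_single zero_word_def)

lemma env_act_add: "env_act scale act (u + w) v = env_act scale act u v + env_act scale act w v"
  by (induction u; induction w) (simp add: plus_env.abs_eq env_act_abs free_act_add)

lemma env_act_mult: "env_act scale act (u * w) v = env_act scale act u (env_act scale act w v)"
  by (induction u; induction w) (simp add: times_env.abs_eq env_act_abs free_act_mult)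

end


section \<open>Modules\<close>

definition locally_finite_on ::
  "env set \<Rightarrow> (complex \<Rightarrow> 'v \<Rightarrow> 'v) \<Rightarrow> (vir \<Rightarrow> 'v \<Rightarrow> 'v::ab_group_add) \<Rightarrow> bool" where
  "locally_finite_on A scale act \<longleftrightarrow>
     (\<forall>v. \<exists>B. finite B \<and> module.span scale B = (\<lambda>u. env_act scale act u v) ` A)"

definition category_W ::
  "(complex \<Rightarrow> 'v \<Rightarrow> 'v) \<Rightarrow> (vir \<Rightarrow> 'v \<Rightarrow> 'v::ab_group_add) \<Rightarrow> bool" where
  "category_W scale act \<longleftrightarrow> vir_module scale act \<and> locally_finite_on U_n_plus scale act"

definition submodule ::
  "(complex \<Rightarrow> 'v \<Rightarrow> 'v) \<Rightarrow> (vir \<Rightarrow> 'v \<Rightarrow> 'v::ab_group_add) \<Rightarrow> 'v set \<Rightarrow> bool" where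
  "submodule scale act W \<longleftrightarrow> module.subspace scale W \<and> (\<forall>x. \<forall>w\<in>W. act x w \<in> W)"

definition fin_gen ::
  "(complex \<Rightarrow> 'v \<Rightarrow> 'v) \<Rightarrow> (vir \<Rightarrow> 'v \<Rightarrow> 'v::ab_group_add) \<Rightarrow> 'v set \<Rightarrow> bool" where
  "fin_gen scale act W \<longleftrightarrow> (\<exists>S. finite S \<and> submodule scale act hull S = W)"

definition z_minus ::
  "(complex \<Rightarrow> 'v \<Rightarrow> 'v) \<Rightarrow> (vir \<Rightarrow> 'v \<Rightarrow> 'v::ab_group_add) \<Rightarrow> complex \<Rightarrow> 'v \<Rightarrow> 'v" where
  "z_minus scale act \<xi> v = act vz v - scale \<xi> v"

definition gen_eigenspace ::
  "(complex \<Rightarrow> 'v \<Rightarrow> 'v) \<Rightarrow> (vir \<Rightarrow> 'v \<Rightarrow> 'v::ab_group_add) \<Rightarrow> complex \<Rightarrow> 'v set" where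
  "gen_eigenspace scale act \<xi> =
     {v. \<forall>\<^sub>F k in sequentially. (z_minus scale act \<xi> ^^ k) v = 0}"

definition filt_eigenspace ::
  "(complex \<Rightarrow> 'v \<Rightarrow> 'v) \<Rightarrow> (vir \<Rightarrow> 'v \<Rightarrow> 'v::ab_group_add) \<Rightarrow> complex \<Rightarrow> nat \<Rightarrow> 'v set" where
  "filt_eigenspace scale act \<xi> i =
     {v \<in> gen_eigenspace scale act \<xi>. (z_minus scale act \<xi> ^^ i) v = 0}"

text \<open>The whole space is the internal direct sum of the family \<open>W\<close> (meant for subspaces).\<close>

definition internal_direct_sum :: "('i \<Rightarrow> 'v::ab_group_add set) \<Rightarrow> bool" where
  "internal_direct_sum W \<longleftrightarrow>
     (\<forall>v. \<exists>!f. finite {i. f i \<noteq> 0} \<and> (\<forall>i. f i \<in> W i) \<and> (\<Sum>i | f i \<noteq> 0. f i) = v)"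

text \<open>On the quotient \<open>W' / W\<close>, \<open>z\<close> sends the coset \<open>v + W\<close> to \<open>z v + W\<close>.\<close>

definition z_acts_on_quotient_by ::
  "(complex \<Rightarrow> 'v \<Rightarrow> 'v) \<Rightarrow> (vir \<Rightarrow> 'v \<Rightarrow> 'v::ab_group_add) \<Rightarrow> complex \<Rightarrow> 'v set \<Rightarrow> 'v set \<Rightarrow> bool"
where
  "z_acts_on_quotient_by scale act \<xi> W' W \<longleftrightarrow>
     (\<forall>v\<in>W'. (+) (act vz v) ` W = (+) (scale \<xi> v) ` W)"

end

theory Submission
  imports Defs "HOL-Computational_Algebra.Fundamental_Theorem_Algebra"
begin

text \<open>
  Write \<open>T\<close> for the action of \<open>z\<close>. As \<open>z\<close> is central in the enveloping algebra
  (\<open>env_gen_vz_central\<close>), \<open>T\<close> commutes with the action of the Lie algebra, so kernels of powers of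
  \<open>T - \<xi>\<close>, and their unions, are submodules. For the same reason the orbit \<open>v, T v, T\<^sup>2 v, \<dots>\<close> lies
  in the finite-dimensional space \<open>Z(\<gg>) v\<close>, so that \<open>v\<close> is killed by \<open>p(T)\<close> for some nonzero
  complex polynomial \<open>p\<close>.

  That \<open>v\<close> is then a sum of generalized eigenvectors follows by splitting off one root \<open>a\<close> of \<open>p\<close>
  at a time: by induction \<open>(T - a) v\<close> is such a sum, and its summands in the \<open>V\<^sub>b\<close> with \<open>b \<noteq> a\<close> can be
  lifted through \<open>T - a\<close>, which is surjective on \<open>V\<^sub>b\<close>; what remains of \<open>v\<close> lies in \<open>V\<^sub>a\<close>
  (\<open>shift_surj_on_geneig\<close>, \<open>span_geneig_shift\<close>). That \<open>T - a\<close> is also injective on \<open>V\<^sub>b\<close> gives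
  the independence of these spaces (\<open>geneig_independent\<close>).

  Both finiteness statements rest on a fact about any decomposition \<open>V = \<Oplus> W\<^sub>i\<close> into submodules:
  the projection to \<open>W\<^sub>i\<close> is a module homomorphism, so a submodule \<open>M\<close> that contains the \<open>i\<close>-th components of a
  generating set contains \<open>W\<^sub>i\<close> (\<open>component_generated\<close>). Taking for \<open>M\<close> the submodule
  generated by these components shows that \<open>W\<^sub>i\<close> is finitely generated. Taking for \<open>M\<close> the kernel of
  \<open>(T - \<xi>)\<^sup>k\<close>, with \<open>k\<close> large enough for the finitely many components of the generators, shows that
  the filtration of \<open>V\<^sub>\<xi>\<close> stops.
\<close>


section \<open>Generalized eigenspaces of a linear operator\<close>

lemma funpow_commute:
  assumes "\<And>v. f (g v) = g (f v)"
  shows "(f ^^ n) (g v) = g ((f ^^ n) v)"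
  by (induction n) (simp_all add: assms)

locale linear_operator = vector_space scale
  for scale :: "'a::field \<Rightarrow> 'v::ab_group_add \<Rightarrow> 'v" +
  fixes T :: "'v \<Rightarrow> 'v"
  assumes T_add: "T (v + w) = T v + T w"
    and T_scale: "T (scale c v) = scale c (T v)"
begin

definition shift :: "'a \<Rightarrow> 'v \<Rightarrow> 'v" where
  "shift a v = T v - scale a v"

definition geneig :: "'a \<Rightarrow> 'v set" where
  "geneig a = {v. \<exists>k. (shift a ^^ k) v = 0}"

lemma T_zero: "T 0 = 0"
  using T_scale[of 0 0] by simp

lemma T_diff: "T (v - w) = T v - T w"
  using T_add[of "v - w" w] by simp

lemma shift_zero: "shift a 0 = 0"
  by (simp add: shift_def T_zero)

lemma shift_add: "shift a (v + w) = shift a v + shift a w"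
  by (simp add: shift_def T_add scale_right_distrib)

lemma shift_diff: "shift a (v - w) = shift a v - shift a w"
  by (simp add: shift_def T_diff scale_right_diff_distrib)

lemma shift_scale: "shift a (scale c v) = scale c (shift a v)"
  by (simp add: shift_def T_scale scale_right_diff_distrib mult.commute)

lemma shift_commute: "shift a (shift b v) = shift b (shift a v)"
  by (simp add: shift_def T_diff T_scale scale_right_diff_distrib algebra_simps)

lemma shift_change: "shift a v = shift b v + scale (b - a) v"
  by (simp add: shift_def scale_left_diff_distrib)

lemma funpow_shift_zero: "(shift a ^^ n) 0 = 0"
  by (induction n) (simp_all add: shift_zero)

lemma funpow_shift_add: "(shift a ^^ n) (v + w) = (shift a ^^ n) v + (shift a ^^ n) w"
  by (induction n) (simp_all add: shift_add)

lemma funpow_shift_scale: "(shift a ^^ n) (scale c v) = scale c ((shift a ^^ n) v)"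
  by (induction n) (simp_all add: shift_scale)

lemma funpow_shift_mono:
  assumes "(shift a ^^ m) v = 0" "m \<le> n"
  shows "(shift a ^^ n) v = 0"
proof -
  have "(shift a ^^ n) v = (shift a ^^ (n - m)) ((shift a ^^ m) v)"
    using assms(2) by (simp flip: funpow_add comp_apply[of "(shift a ^^ (n - m))"])
  then show ?thesis using assms(1) by (simp add: funpow_shift_zero)
qed

lemma subspace_geneig: "subspace (geneig a)"
proof (rule subspaceI)
  show "0 \<in> geneig a" by (auto simp: geneig_def intro: exI[of _ 0])
next
  fix v w assume "v \<in> geneig a" "w \<in> geneig a"
  then obtain m n where mn: "(shift a ^^ m) v = 0" "(shift a ^^ n) w = 0"
    by (auto simp: geneig_def)
  have "(shift a ^^ (max m n)) (v + w) = 0"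
    using funpow_shift_mono[OF mn(1), of "max m n"] funpow_shift_mono[OF mn(2), of "max m n"]
    by (simp add: funpow_shift_add)
  then show "v + w \<in> geneig a" by (auto simp: geneig_def)
next
  fix c v assume "v \<in> geneig a"
  then show "scale c v \<in> geneig a"
    by (auto simp: geneig_def funpow_shift_scale)
qed

lemma geneig_shift:
  assumes "v \<in> geneig b"
  shows "shift a v \<in> geneig b"
proof -
  obtain k where "(shift b ^^ k) v = 0" using assms by (auto simp: geneig_def)
  then have "(shift b ^^ k) (shift a v) = 0"
    by (simp add: funpow_commute shift_commute shift_zero)
  then show ?thesis by (auto simp: geneig_def)
qed

lemma geneig_shift_iff: "shift b v \<in> geneig b \<longleftrightarrow> v \<in> geneig b"
proof
  assume "shift b v \<in> geneig b"
  then obtain k where "(shift b ^^ k) (shift b v) = 0"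
    by (auto simp: geneig_def)
  then have "(shift b ^^ Suc k) v = 0" by (simp add: funpow_swap1)
  then show "v \<in> geneig b" unfolding geneig_def by blast
qed (rule geneig_shift)

text \<open>On the kernel of \<open>T - a\<close> the operator \<open>T - b\<close> acts as the nonzero scalar \<open>a - b\<close>, so no power
  of it kills a nonzero vector.\<close>

lemma shift_inj_on_geneig:
  assumes "a \<noteq> b" "v \<in> geneig b" "shift a v = 0"
  shows "v = 0"
proof -
  obtain k where k: "(shift b ^^ k) v = 0" using assms(2) by (auto simp: geneig_def)
  have eig: "shift b v = scale (a - b) v"
    using shift_change[of b v a] assms(3) by simp
  have "(shift b ^^ n) v = scale ((a - b) ^ n) v" for n
    by (induction n) (simp_all add: shift_scale eig mult.commute)
  then show ?thesis using k assms(1) by simp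
qed

lemma funpow_shift_inj_on_geneig:
  assumes "a \<noteq> b" "v \<in> geneig b" "(shift a ^^ n) v = 0"
  shows "v = 0"
  using assms(2,3)
proof (induction n arbitrary: v)
  case (Suc n)
  then have "shift a v = 0"
    using geneig_shift by (simp add: funpow_swap1)
  then show ?case using assms(1) Suc.prems(1) shift_inj_on_geneig by blast
qed simp

text \<open>If \<open>N = T - b\<close> is nilpotent on \<open>w\<close>, then \<open>T - a = N + (b - a)\<close> can be inverted there by a
  geometric series; the induction on the nilpotency order replaces the series.\<close>

lemma shift_surj_on_geneig:
  assumes "a \<noteq> b" "w \<in> geneig b"
  shows "\<exists>u\<in>geneig b. shift a u = w"
proof -
  have "\<exists>u\<in>geneig b. shift a u = w" if "(shift b ^^ k) w = 0" for k w
    using that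
  proof (induction k arbitrary: w)
    case 0
    then show ?case using subspace_0[OF subspace_geneig] shift_zero by auto
  next
    case (Suc k)
    have w: "w \<in> geneig b" using Suc.prems unfolding geneig_def by blast
    obtain u where u: "u \<in> geneig b" "shift a u = shift b w"
      using Suc by (metis comp_apply funpow_Suc_right)
    \<comment> \<open>Solve \<open>(T - a) w = (T - b) w + (b - a) w = (T - a) u + (b - a) w\<close> for its last term.\<close>
    have "shift a (scale (inverse (b - a)) (w - u)) = w"
      using assms(1) shift_change[of a w b]
      by (simp add: shift_scale shift_diff u)
    moreover have "scale (inverse (b - a)) (w - u) \<in> geneig b"
      by (intro subspace_scale subspace_diff subspace_geneig w u)
    ultimately show ?case by blast
  qed
  then show ?thesis using assms(2) by (auto simp: geneig_def)
qed

text \<open>A power of \<open>T - b\<close> removes the summand in the eigenspace of \<open>b\<close> from a relation and is injective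
  on the others, so the number of summands can be lowered by one.\<close>

lemma geneig_independent:
  assumes "finite F" "\<And>a. a \<in> F \<Longrightarrow> f a \<in> geneig a" "sum f F = 0" "a \<in> F"
  shows "f a = 0"
  using assms
proof (induction F arbitrary: f a rule: finite_induct)
  case (insert b F)
  have fb: "f b \<in> geneig b" using insert.prems by simp
  then obtain k where k: "(shift b ^^ k) (f b) = 0" by (auto simp: geneig_def)
  have geneig_pow: "(shift b ^^ k) v \<in> geneig c" if "v \<in> geneig c" for v c
    using that by (induction k) (auto intro: geneig_shift)
  have "(shift b ^^ k) (sum f F) = (\<Sum>c\<in>F. (shift b ^^ k) (f c))"
    by (induction F rule: infinite_finite_induct)
      (simp_all add: funpow_shift_zero funpow_shift_add)
  moreover have "(shift b ^^ k) (f b + sum f F) = 0"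
    using insert by (simp add: funpow_shift_zero)
  ultimately have sum0: "(\<Sum>c\<in>F. (shift b ^^ k) (f c)) = 0"
    by (simp add: funpow_shift_add k)
  have "(shift b ^^ k) (f c) = 0" if "c \<in> F" for c
    by (rule insert.IH[of "\<lambda>c. (shift b ^^ k) (f c)"]) (use insert.prems that sum0 geneig_pow in auto)
  then have F0: "f c = 0" if "c \<in> F" for c
    using that insert.hyps(2) insert.prems(1) funpow_shift_inj_on_geneig[of b c "f c" k] by auto
  then have "f b = 0" using insert.prems(2) insert.hyps by simp
  then show ?case using F0 insert.prems(3) by auto
qed simp

text \<open>Modulo the generalized eigenspace of \<open>a\<close>, every sum of generalized eigenvectors lies in the image
  under \<open>T - a\<close> of another such sum \<open>u\<close>. If \<open>(T - a) v\<close> is the given sum, then \<open>(T - a) (v - u)\<close> is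
  a generalized eigenvector for \<open>a\<close>, and hence so is \<open>v - u\<close>.\<close>

lemma span_geneig_shift:
  assumes "shift a v \<in> span (\<Union>(range geneig))"
  shows "v \<in> span (\<Union>(range geneig))"
proof -
  let ?S = "span (\<Union>(range geneig))"
  have "\<exists>u\<in>?S. w - shift a u \<in> geneig a" if "w \<in> ?S" for w
    using that
  proof (induction rule: span_induct_alt)
    case base
    then show ?case
      by (intro bexI[of _ 0] span_zero) (simp add: shift_zero subspace_0[OF subspace_geneig])
  next
    case (step c x y)
    then obtain b u where x: "x \<in> geneig b" and u: "u \<in> ?S" "y - shift a u \<in> geneig a" by auto
    show ?case
    proof (cases "b = a")
      case True
      have "scale c x + (y - shift a u) \<in> geneig a"
        using x u True by (intro subspace_add subspace_scale subspace_geneig) auto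
      then show ?thesis using u by (intro bexI[of _ u]) (simp_all add: algebra_simps)
    next
      case False
      then obtain t where t: "t \<in> geneig b" "shift a t = x"
        using shift_surj_on_geneig x by metis
      have "scale c x + y - shift a (scale c t + u) = y - shift a u"
        by (simp add: shift_add shift_scale t)
      moreover have "scale c t + u \<in> ?S"
        using t u by (intro span_add span_scale) (auto intro: span_base)
      ultimately show ?thesis using u by metis
    qed
  qed
  then obtain u where u: "u \<in> ?S" "shift a (v - u) \<in> geneig a"
    using assms by (auto simp: shift_diff)
  then have "v - u \<in> ?S"
    by (auto simp: geneig_shift_iff intro!: span_base)
  then show ?thesis using u(1) span_add by fastforce
qed

definition poly_op :: "'a poly \<Rightarrow> 'v \<Rightarrow> 'v" where
  "poly_op p v = (\<Sum>i\<le>degree p. scale (coeff p i) ((T ^^ i) v))"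

lemma poly_op_bound:
  assumes "degree p \<le> n"
  shows "poly_op p v = (\<Sum>i\<le>n. scale (coeff p i) ((T ^^ i) v))"
  unfolding poly_op_def
  by (rule sum.mono_neutral_left) (use assms in \<open>auto simp: coeff_eq_0\<close>)

lemma poly_op_linear_factor: "poly_op ([:- a, 1:] * q) v = poly_op q (shift a v)"
proof -
  have add: "(T ^^ i) (x + y) = (T ^^ i) x + (T ^^ i) y"
    and scale: "(T ^^ i) (scale c x) = scale c ((T ^^ i) x)" for i x y c
    by (induction i) (simp_all add: T_add T_scale)
  have pow: "(T ^^ i) (shift a v) = (T ^^ Suc i) v - scale a ((T ^^ i) v)" for i
    using add[of i "T v" "scale (- a) v"] scale[of i "- a" v]
    by (simp add: shift_def funpow_swap1)
  let ?n = "Suc (degree q)"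
  have "poly_op ([:- a, 1:] * q) v
      = (\<Sum>i\<le>?n. scale (coeff (pCons 0 q) i) ((T ^^ i) v) - scale (a * coeff q i) ((T ^^ i) v))"
    by (subst poly_op_bound[of _ ?n])
      (auto simp: scale_left_diff_distrib intro!: degree_diff_le order.trans[OF degree_pCons_le]
        order.trans[OF degree_smult_le] sum.cong)
  also have "\<dots> = (\<Sum>i\<le>?n. scale (coeff (pCons 0 q) i) ((T ^^ i) v))
      - (\<Sum>i\<le>?n. scale (a * coeff q i) ((T ^^ i) v))"
    by (rule sum_subtractf)
  also have "\<dots> = (\<Sum>i\<le>degree q. scale (coeff q i) ((T ^^ Suc i) v))
      - (\<Sum>i\<le>degree q. scale (a * coeff q i) ((T ^^ i) v))"
    unfolding sum.atMost_Suc_shift[where g = "\<lambda>i. scale (coeff (pCons 0 q) i) ((T ^^ i) v)"]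
    by (simp add: coeff_eq_0 del: funpow.simps)
  also have "\<dots> = poly_op q (shift a v)"
    unfolding poly_op_def pow
    by (simp add: scale_right_diff_distrib sum_subtractf mult.commute del: funpow.simps)
  finally show ?thesis .
qed

text \<open>Each root of \<open>p\<close> peels off one factor \<open>T - a\<close>, which \<open>span_geneig_shift\<close> undoes; a nonzero
  constant polynomial kills only \<open>0\<close>.\<close>

lemma annihilated_imp_span_geneig:
  assumes closed: "\<And>p :: 'a poly. degree p > 0 \<Longrightarrow> \<exists>a. poly p a = 0"
    and "p \<noteq> 0" "poly_op p v = 0"
  shows "v \<in> span (\<Union>(range geneig))"
  using assms(2,3)
proof (induction "degree p" arbitrary: p v)
  case 0
  then obtain c where "p = [:c:]" "c \<noteq> 0" by (metis degree_eq_zeroE pCons_0_0)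
  then have "v = 0" using 0 by (simp add: poly_op_def)
  then show ?case by (simp add: span_zero)
next
  case (Suc n)
  obtain a where "poly p a = 0" using closed Suc.hyps(2) by (metis zero_less_Suc)
  then obtain q where p: "p = [:- a, 1:] * q" by (metis dvdE poly_eq_0_iff_dvd)
  have q: "q \<noteq> 0" using p Suc.prems by auto
  have "degree p = Suc (degree q)" unfolding p using q by (subst degree_mult_eq) auto
  then have "shift a v \<in> span (\<Union>(range geneig))"
    using Suc.hyps q Suc.prems(2) unfolding p poly_op_linear_factor by simp
  then show ?case by (rule span_geneig_shift)
qed

text \<open>The \<open>card B + 1\<close> vectors \<open>T\<^sup>i v\<close> with \<open>i \<le> card B\<close> satisfy a nontrivial linear relation, whose
  coefficients are those of \<open>p\<close>.\<close>

lemma finite_orbit_imp_annihilated: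
  assumes "finite B" "\<And>n. (T ^^ n) v \<in> span B"
  shows "\<exists>p. p \<noteq> 0 \<and> poly_op p v = 0"
proof -
  let ?n = "card B" and ?f = "\<lambda>i. (T ^^ i) v"
  have "\<exists>c. (\<exists>i\<le>?n. c i \<noteq> 0) \<and> (\<Sum>i\<le>?n. scale (c i) (?f i)) = 0"
  proof (cases "inj_on ?f {..?n}")
    case True
    have "dependent (?f ` {..?n})"
    proof (rule ccontr)
      assume "\<not> dependent (?f ` {..?n})"
      then have "card (?f ` {..?n}) \<le> card B"
        using independent_span_bound[OF assms(1)] assms(2) by blast
      then show False using True by (simp add: card_image)
    qed
    then obtain u where "\<exists>w\<in>?f ` {..?n}. u w \<noteq> 0" "(\<Sum>w\<in>?f ` {..?n}. scale (u w) w) = 0"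
      by (auto simp: dependent_finite)
    then show ?thesis
      using True by (intro exI[of _ "\<lambda>i. u (?f i)"]) (auto simp: sum.reindex)
  next
    \<comment> \<open>A repetition in the orbit is not a dependence of the set of its members; it gives the
      relation \<open>T\<^sup>i v - T\<^sup>j v = 0\<close> instead.\<close>
    case False
    then obtain i j where ij: "i \<le> ?n" "j \<le> ?n" "i \<noteq> j" "?f i = ?f j"
      by (auto simp: inj_on_def)
    have "(\<Sum>k\<le>?n. scale ((if k = i then 1 else 0) - (if k = j then 1 else 0)) (?f k))
        = (\<Sum>k\<le>?n. (if k = i then ?f k else 0) - (if k = j then ?f k else 0))"
      by (rule sum.cong) auto
    also have "\<dots> = 0"
      using ij by (simp add: sum_subtractf)
    finally show ?thesis
      using ij by (intro exI[of _ "\<lambda>k. (if k = i then 1 else 0) - (if k = j then 1 else 0)"]) auto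
  qed
  then obtain c i where c: "i \<le> ?n" "c i \<noteq> 0" "(\<Sum>i\<le>?n. scale (c i) (?f i)) = 0" by blast
  define p where "p = (\<Sum>i\<le>?n. monom (c i) i)"
  have coeff: "coeff p j = (if j \<le> ?n then c j else 0)" for j
    by (simp add: p_def coeff_sum)
  then have "degree p \<le> ?n" by (intro degree_le) simp
  then have "poly_op p v = (\<Sum>i\<le>?n. scale (c i) (?f i))"
    by (simp add: poly_op_bound coeff)
  moreover have "p \<noteq> 0" using coeff[of i] c by auto
  ultimately show ?thesis using c by auto
qed

end


section \<open>Internal direct sums\<close>

context vector_space
begin

lemma internal_direct_sumI:
  assumes sub: "\<And>i. subspace (W i)"
    and gen: "span (\<Union>(range W)) = UNIV"
    and indep: "\<And>F f i. finite F \<Longrightarrow> (\<And>i. i \<in> F \<Longrightarrow> f i \<in> W i) \<Longrightarrow> sum f F = 0 \<Longrightarrow> i \<in> F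
      \<Longrightarrow> f i = 0"
  shows "internal_direct_sum W"
  unfolding internal_direct_sum_def
proof
  fix v
  define dec where
    "dec v f \<longleftrightarrow> finite {i. f i \<noteq> 0} \<and> (\<forall>i. f i \<in> W i) \<and> (\<Sum>i | f i \<noteq> 0. f i) = v" for v f
  have "v \<in> span (\<Union>(range W))" using gen by simp
  then have "\<exists>f. dec v f"
  proof (induction rule: span_induct_alt)
    case base
    then show ?case
      by (intro exI[of _ "\<lambda>_. 0"]) (simp add: dec_def subspace_0[OF sub])
  next
    case (step c x y)
    then obtain f i where f: "dec y f" and x: "x \<in> W i" by auto
    let ?g = "\<lambda>j. (if j = i then scale c x else 0) + f j"
    let ?F = "insert i {j. f j \<noteq> 0}"
    have fin: "finite ?F" using f by (simp add: dec_def)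
    have supp: "{j. ?g j \<noteq> 0} \<subseteq> ?F" by auto
    have "(\<Sum>j | ?g j \<noteq> 0. ?g j) = sum ?g ?F"
      by (rule sum.mono_neutral_left[OF fin supp]) auto
    also have "\<dots> = scale c x + sum f ?F"
      using fin by (simp add: sum.distrib del: sum.insert sum.insert_if)
    also have "sum f ?F = (\<Sum>j | f j \<noteq> 0. f j)"
      by (rule sum.mono_neutral_right[OF fin]) auto
    finally have "dec (scale c x + y) ?g"
      using f x finite_subset[OF supp fin]
      by (auto simp: dec_def intro!: subspace_add sub subspace_scale)
    then show ?case by blast
  qed
  moreover have "f = g" if fg: "dec v f" "dec v g" for f g
  proof
    fix i
    let ?F = "{i. f i \<noteq> 0} \<union> {i. g i \<noteq> 0}"
    have fin: "finite ?F" using fg by (simp add: dec_def)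
    have "sum h ?F = v" if "dec v h" "{i. h i \<noteq> 0} \<subseteq> ?F" for h
    proof -
      have "sum h ?F = (\<Sum>i | h i \<noteq> 0. h i)"
        by (rule sum.mono_neutral_right[OF fin that(2)]) blast
      then show ?thesis using that(1) by (simp add: dec_def)
    qed
    then have "sum f ?F = v" "sum g ?F = v" using fg by blast+
    then have "(\<Sum>i\<in>?F. f i - g i) = 0" by (simp add: sum_subtractf)
    moreover have "f i - g i \<in> W i" for i
      using fg by (intro subspace_diff sub) (simp_all add: dec_def)
    ultimately have "f i - g i = 0" if "i \<in> ?F"
      by (intro indep[of ?F "\<lambda>i. f i - g i", OF fin _ _ that])
    then show "f i = g i" by (cases "i \<in> ?F") auto
  qed
  ultimately show "\<exists>!f. finite {i. f i \<noteq> 0} \<and> (\<forall>i. f i \<in> W i) \<and> (\<Sum>i | f i \<noteq> 0. f i) = v"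
    unfolding dec_def[symmetric] by blast
qed

end

definition component :: "('i \<Rightarrow> 'v::ab_group_add set) \<Rightarrow> 'i \<Rightarrow> 'v \<Rightarrow> 'v" where
  "component W i v =
     (THE f. finite {i. f i \<noteq> 0} \<and> (\<forall>i. f i \<in> W i) \<and> (\<Sum>i | f i \<noteq> 0. f i) = v) i"

lemma component_props:
  assumes "internal_direct_sum W"
  shows finite_component: "finite {i. component W i v \<noteq> 0}"
    and component_in: "component W i v \<in> W i"
    and sum_component: "(\<Sum>i | component W i v \<noteq> 0. component W i v) = v"
proof -
  define f where
    "f = (THE f. finite {i. f i \<noteq> 0} \<and> (\<forall>i. f i \<in> W i) \<and> (\<Sum>i | f i \<noteq> 0. f i) = v)"
  have comp: "component W i v = f i" for i
    by (simp add: component_def f_def)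
  have "finite {i. f i \<noteq> 0} \<and> (\<forall>i. f i \<in> W i) \<and> (\<Sum>i | f i \<noteq> 0. f i) = v"
    unfolding f_def
    by (rule theI'[OF assms[unfolded internal_direct_sum_def, THEN spec]])
  then show "finite {i. component W i v \<noteq> 0}" "component W i v \<in> W i"
    "(\<Sum>i | component W i v \<noteq> 0. component W i v) = v"
    by (simp_all add: comp)
qed

lemma component_eqI:
  assumes "internal_direct_sum W" "finite F" "\<And>i. f i \<in> W i" "\<And>i. i \<notin> F \<Longrightarrow> f i = 0"
    "sum f F = v"
  shows "component W i v = f i"
proof -
  have supp: "{i. f i \<noteq> 0} \<subseteq> F" using assms(4) by auto
  have "(\<Sum>i | f i \<noteq> 0. f i) = v"
    using sum.mono_neutral_left[OF assms(2) supp, of f] assms(5) by simp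
  then have "finite {i. f i \<noteq> 0} \<and> (\<forall>i. f i \<in> W i) \<and> (\<Sum>i | f i \<noteq> 0. f i) = v"
    using assms(3) finite_subset[OF supp assms(2)] by auto
  moreover have "\<exists>!f. finite {i. f i \<noteq> 0} \<and> (\<forall>i. f i \<in> W i) \<and> (\<Sum>i | f i \<noteq> 0. f i) = v"
    using assms(1) unfolding internal_direct_sum_def by blast
  ultimately show ?thesis unfolding component_def by (simp add: the1_equality)
qed

lemma component_same:
  assumes "internal_direct_sum W" "\<And>i. 0 \<in> W i" "v \<in> W i"
  shows "component W i v = v"
  using component_eqI[OF assms(1), of "{i}" "\<lambda>j. if j = i then v else 0" v i] assms by auto

lemma component_add:
  assumes "internal_direct_sum W" "\<And>i x y. x \<in> W i \<Longrightarrow> y \<in> W i \<Longrightarrow> x + y \<in> W i"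
  shows "component W i (v + w) = component W i v + component W i w"
proof -
  let ?F = "{i. component W i v \<noteq> 0} \<union> {i. component W i w \<noteq> 0}"
  note props = component_props[OF assms(1)]
  have fin: "finite ?F" by (simp add: props)
  have "(\<Sum>i\<in>?F. component W i x) = x" if "{i. component W i x \<noteq> 0} \<subseteq> ?F" for x
    using sum.mono_neutral_left[OF fin that, of "\<lambda>i. component W i x"] props(3)[of x] by auto
  then have "(\<Sum>i\<in>?F. component W i v + component W i w) = v + w"
    by (simp add: sum.distrib)
  then show ?thesis
    by (intro component_eqI[OF assms(1) fin]) (auto intro: assms(2) props(2))
qed

text \<open>Applying \<open>L\<close> to the decomposition of \<open>v\<close> gives a decomposition of \<open>L v\<close>, which is unique.\<close>

lemma component_commute:
  fixes W :: "'a \<Rightarrow> 'b::ab_group_add set"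
  assumes "internal_direct_sum W" "\<And>x y. L (x + y) = L x + L y" "\<And>i x. x \<in> W i \<Longrightarrow> L x \<in> W i"
  shows "component W i (L v) = L (component W i v)"
proof -
  note props = component_props[OF assms(1)]
  have L0: "L 0 = 0" using assms(2)[of 0 0] by simp
  have "L (sum f F) = (\<Sum>i\<in>F. L (f i))" for F and f :: "'a \<Rightarrow> 'b"
    by (induction F rule: infinite_finite_induct) (simp_all add: L0 assms(2))
  from this[of "\<lambda>i. component W i v" "{i. component W i v \<noteq> 0}"]
  have "(\<Sum>i | component W i v \<noteq> 0. L (component W i v)) = L v"
    by (simp add: props(3))
  then show ?thesis
    by (intro component_eqI[OF assms(1) props(1)[of v]]) (auto intro: assms(3) props(2) simp: L0)
qed


section \<open>The central element of the enveloping algebra\<close>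

lemma env_gen_bracket:
  "env_gen (vir_bracket x y) = env_gen x * env_gen y - env_gen y * env_gen x"
proof (transfer)
  fix x y
  have "- (fgen x * fgen y - fgen y * fgen x - fgen (vir_bracket x y)) \<in> env_ideal"
    by (intro env_ideal_uminus env_ideal.rel_bracket)
  then show "env_rel (fgen (vir_bracket x y)) (fgen x * fgen y - fgen y * fgen x)"
    by (simp add: env_rel_def)
qed

lemma env_gen_zero: "env_gen 0 = 0"
  using env_gen_bracket[of vz vz] by simp

lemma env_const_commute: "env_const c * u = u * env_const c"
proof (transfer)
  fix c and t :: free_vir
  have "fconst c * t = t * fconst c"
    by (induction t rule: poly_mapping_sum_induct)
      (simp_all add: fconst_def mult_single distrib_left distrib_right mult.commute)
  then show "env_rel (fconst c * t) (t * fconst c)"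
    by (simp add: env_rel_def env_ideal.zero)
qed

text \<open>The enveloping algebra is spanned by words in elements of \<open>\<gg>\<close>, and \<open>z\<close> can be moved through a
  word one letter at a time.\<close>

lemma env_gen_vz_central: "env_gen vz \<in> center"
proof -
  have gen: "env_gen vz * env_gen x = env_gen x * env_gen vz" for x
    using env_gen_bracket[of vz x] by (simp add: env_gen_zero)
  have word: "env_gen vz * abs_env (Poly_Mapping.single (Word xs) c)
      = abs_env (Poly_Mapping.single (Word xs) c) * env_gen vz" for xs c
  proof (induction xs)
    case Nil
    have "abs_env (Poly_Mapping.single (Word []) c) = env_const c"
      by (simp add: env_const_def fconst_def zero_word_def)
    then show ?case by (simp add: env_const_commute)
  next
    case (Cons x xs)
    have "abs_env (Poly_Mapping.single (Word (x # xs)) c)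
        = env_gen x * abs_env (Poly_Mapping.single (Word xs) c)"
      by (simp add: env_gen_def fgen_def times_env.abs_eq mult_single plus_word_def)
    then show ?case using Cons gen by (metis mult.assoc)
  qed
  have "env_gen vz * abs_env t = abs_env t * env_gen vz" for t
  proof (induction t rule: poly_mapping_sum_induct)
    case zero
    then show ?case by (simp flip: zero_env_def)
  next
    case (single w c)
    then show ?case using word by (cases w) simp
  next
    case (add a b)
    then show ?case by (simp add: distrib_left distrib_right flip: plus_env.abs_eq)
  qed
  then have "env_gen vz * u = u * env_gen vz" for u
    by (induction u rule: env.abs_induct)
  then show ?thesis unfolding center_def by simp
qed

lemma center_power: "u \<in> center \<Longrightarrow> u ^ n \<in> center"
  by (auto simp: center_def power_commuting_commutes)


section \<open>Modules over the Virasoro algebra\<close>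

sublocale vir_module \<subseteq> z: linear_operator scale "act vz"
  by unfold_locales (simp_all add: act_add_right act_scale_right)

context vir_module
begin

lemma act_zero_left: "act 0 v = 0"
  using act_add_left[of 0 0 v] by simp

lemma z_minus_shift: "z_minus scale act = z.shift"
  by (intro ext) (simp add: z_minus_def z.shift_def)

lemma gen_eigenspace_geneig: "gen_eigenspace scale act = z.geneig"
proof
  fix a
  have "(\<exists>m. \<forall>k\<ge>m. (z.shift a ^^ k) v = 0) \<longleftrightarrow> (\<exists>m. (z.shift a ^^ m) v = 0)" for v
  proof
    assume "\<exists>m. (z.shift a ^^ m) v = 0"
    then obtain m where "(z.shift a ^^ m) v = 0" ..
    then have "(z.shift a ^^ k) v = 0" if "m \<le> k" for k
      using that by (rule z.funpow_shift_mono)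
    then show "\<exists>m. \<forall>k\<ge>m. (z.shift a ^^ k) v = 0" by blast
  qed auto
  then show "gen_eigenspace scale act a = z.geneig a"
    by (simp add: gen_eigenspace_def z.geneig_def z_minus_shift eventually_sequentially)
qed

text \<open>The filtration steps are plain kernels: a vector killed by one power of \<open>z - a\<close> is a generalized
  eigenvector. So the filtration is the same whether it is taken in \<open>V\<^sub>a\<close> or in the whole module.\<close>

lemma filt_eigenspace_kernel: "filt_eigenspace scale act a i = {v. (z.shift a ^^ i) v = 0}"
  by (auto simp: filt_eigenspace_def gen_eigenspace_geneig z_minus_shift z.geneig_def)

lemma funpow_shift_act: "(z.shift a ^^ n) (act x v) = act x ((z.shift a ^^ n) v)"
proof (rule funpow_commute)
  have "act x (v - w) = act x v - act x w" for v w
    using act_add_right[of x v "- w"] by (simp add: act_uminus_right)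
  moreover have "act vz (act x v) = act x (act vz v)" for v
    using act_bracket[of vz x v] by (simp add: act_zero_left)
  ultimately show "z.shift a (act x v) = act x (z.shift a v)" for v
    by (simp add: z.shift_def act_scale_right)
qed

lemma submodule_gen_eigenspace: "submodule scale act (gen_eigenspace scale act a)"
  unfolding submodule_def gen_eigenspace_geneig
proof (intro conjI allI ballI)
  fix x w assume "w \<in> z.geneig a"
  then obtain k where "(z.shift a ^^ k) w = 0" by (auto simp: z.geneig_def)
  then have "(z.shift a ^^ k) (act x w) = 0" by (simp add: funpow_shift_act act_zero_right)
  then show "act x w \<in> z.geneig a" by (auto simp: z.geneig_def)
qed (rule z.subspace_geneig)

lemma submodule_filt_eigenspace: "submodule scale act (filt_eigenspace scale act a i)"
  unfolding submodule_def filt_eigenspace_kernel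
  by (auto intro!: subspaceI simp: z.funpow_shift_zero z.funpow_shift_add z.funpow_shift_scale
      funpow_shift_act act_zero_right)

lemma filt_eigenspace_mono:
  "filt_eigenspace scale act a i \<subseteq> filt_eigenspace scale act a (Suc i)"
  by (auto simp: filt_eigenspace_kernel z.shift_zero)

lemma subspace_coset_eq:
  assumes "subspace W" "x - y \<in> W"
  shows "(+) x ` W = (+) y ` W"
proof -
  have "(+) x ` W \<subseteq> (+) y ` W" if "x - y \<in> W" for x y
  proof
    fix t assume "t \<in> (+) x ` W"
    then obtain w where "w \<in> W" "t = x + w" by auto
    then show "t \<in> (+) y ` W"
      using subspace_add[OF assms(1) that, of w] by (intro image_eqI[of _ _ "x - y + w"]) auto
  qed
  moreover have "y - x \<in> W" using subspace_neg[OF assms] by simp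
  ultimately show ?thesis using assms(2) by blast
qed

lemma z_acts_on_filtration_quotient:
  "z_acts_on_quotient_by scale act a
     (filt_eigenspace scale act a (Suc i)) (filt_eigenspace scale act a i)"
  unfolding z_acts_on_quotient_by_def
proof
  fix v assume "v \<in> filt_eigenspace scale act a (Suc i)"
  then have "z.shift a v \<in> filt_eigenspace scale act a i"
    by (simp add: filt_eigenspace_kernel funpow_swap1)
  then show "(+) (act vz v) ` filt_eigenspace scale act a i
      = (+) (scale a v) ` filt_eigenspace scale act a i"
    using submodule_filt_eigenspace[of a i]
    by (intro subspace_coset_eq) (auto simp: submodule_def z.shift_def)
qed

lemma env_act_power_gen: "env_act scale act (env_gen x ^ n) v = (act x ^^ n) v"
  by (induction n) (simp_all add: env_act_one env_act_mult env_act_gen)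

lemma internal_direct_sum_gen_eigenspace:
  assumes "locally_finite_on center scale act"
  shows "internal_direct_sum (gen_eigenspace scale act)"
  unfolding gen_eigenspace_geneig
proof (rule internal_direct_sumI)
  have "v \<in> span (\<Union>(range z.geneig))" for v
  proof -
    obtain B where B: "finite B" "span B = (\<lambda>u. env_act scale act u v) ` center"
      using assms unfolding locally_finite_on_def by blast
    have "(act vz ^^ n) v \<in> span B" for n
      unfolding B(2) using center_power[OF env_gen_vz_central]
      by (intro image_eqI[of _ _ "env_gen vz ^ n"]) (simp_all add: env_act_power_gen)
    then obtain p where p: "p \<noteq> 0" "z.poly_op p v = 0"
      using z.finite_orbit_imp_annihilated[OF B(1), of v] by auto
    have "\<exists>a. poly p a = 0" if "degree p > 0" for p :: "complex poly"
      using that fundamental_theorem_of_algebra[of p] by (simp add: constant_degree)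
    then show ?thesis using p by (rule z.annihilated_imp_span_geneig)
  qed
  then show "span (\<Union>(range z.geneig)) = UNIV" by blast
  show "f i = 0" if "finite F" "\<And>j. j \<in> F \<Longrightarrow> f j \<in> z.geneig j" "sum f F = 0" "i \<in> F" for F f i
    using that by (rule z.geneig_independent)
qed (rule z.subspace_geneig)

lemma component_act:
  assumes "internal_direct_sum W" "\<And>i. submodule scale act (W i)"
  shows "component W i (act x v) = act x (component W i v)"
  by (rule component_commute[where L = "act x", OF assms(1)])
    (use assms(2) in \<open>auto simp: submodule_def act_add_right\<close>)

lemma submodule_component_vimage:
  assumes W: "internal_direct_sum W" "\<And>i. submodule scale act (W i)"
    and M: "submodule scale act M"
  shows "submodule scale act {v. component W i v \<in> M}"
proof -
  have sub: "subspace (W j)" for j using W(2) by (simp add: submodule_def)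
  have "component W i (scale c v) = scale c (component W i v)" for c v
    by (rule component_commute[where L = "scale c", OF W(1)])
      (auto simp: scale_right_distrib intro: subspace_scale sub)
  moreover have "component W i (v + w) = component W i v + component W i w" for v w
    by (rule component_add[OF W(1)]) (auto intro: subspace_add sub)
  moreover have "component W i 0 = 0"
    by (rule component_same[OF W(1)]) (auto intro: subspace_0 sub)
  ultimately show ?thesis
    using M unfolding submodule_def subspace_def by (simp add: component_act[OF W])
qed

text \<open>The vectors whose \<open>i\<close>-th component lies in \<open>M\<close> form a submodule. It contains the generators, so
  it is everything, and on \<open>W i\<close> the component is the vector itself.\<close>

lemma component_generated:
  assumes W: "internal_direct_sum W" "\<And>i. submodule scale act (W i)"
    and M: "submodule scale act M"
    and S: "submodule scale act hull S = UNIV" "\<And>s. s \<in> S \<Longrightarrow> component W i s \<in> M"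
  shows "W i \<subseteq> M"
proof
  fix v assume "v \<in> W i"
  then have "component W i v = v"
    by (intro component_same W) (use W(2) in \<open>auto simp: submodule_def intro: subspace_0\<close>)
  moreover have "submodule scale act hull S \<subseteq> {v. component W i v \<in> M}"
    by (rule hull_minimal) (use S submodule_component_vimage[OF W M] in auto)
  moreover have "v \<in> submodule scale act hull S" by (simp add: S(1))
  ultimately show "v \<in> M" by auto
qed

lemma submodule_hull: "submodule scale act (submodule scale act hull S)"
  by (rule hull_in) (auto simp: submodule_def intro!: subspace_Inter)

lemma fin_gen_component:
  assumes W: "internal_direct_sum W" "\<And>i. submodule scale act (W i)"
    and "fin_gen scale act UNIV"
  shows "fin_gen scale act (W i)"
proof -
  obtain S where S: "finite S" "submodule scale act hull S = UNIV"
    using assms(3) by (auto simp: fin_gen_def)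
  let ?M = "submodule scale act hull (component W i ` S)"
  have "W i \<subseteq> ?M"
    by (rule component_generated[OF W submodule_hull S(2)]) (auto intro: hull_inc)
  moreover have "?M \<subseteq> W i"
    by (rule hull_minimal) (auto intro: component_in W)
  ultimately show ?thesis
    unfolding fin_gen_def using S(1) by (intro exI[of _ "component W i ` S"]) auto
qed

text \<open>The components of the finitely many generators are killed by a common power of \<open>z - a\<close>, and the
  kernel of that power is a submodule, so it contains all of \<open>V\<^sub>a\<close>.\<close>

lemma filtration_exhausts:
  assumes ds: "internal_direct_sum (gen_eigenspace scale act)"
    and "fin_gen scale act UNIV"
  shows "\<exists>k. filt_eigenspace scale act a k = gen_eigenspace scale act a"
proof -
  let ?V = "gen_eigenspace scale act"
  obtain S where S: "finite S" "submodule scale act hull S = UNIV"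
    using assms(2) by (auto simp: fin_gen_def)
  have "\<forall>s\<in>S. \<exists>k. (z.shift a ^^ k) (component ?V a s) = 0"
    using component_in[OF ds, of a] by (auto simp: gen_eigenspace_geneig z.geneig_def)
  then obtain k where k: "\<And>s. s \<in> S \<Longrightarrow> (z.shift a ^^ k s) (component ?V a s) = 0"
    by metis
  have "component ?V a s \<in> filt_eigenspace scale act a (Max (k ` S))" if "s \<in> S" for s
    unfolding filt_eigenspace_kernel
    using z.funpow_shift_mono[OF k[OF that]] that S(1) by auto
  then have "?V a \<subseteq> filt_eigenspace scale act a (Max (k ` S))"
    using component_generated[OF ds submodule_gen_eigenspace submodule_filt_eigenspace S(2)]
    by blast
  then show ?thesis by (auto simp: filt_eigenspace_def)
qed

end

theorem proposition4p1:
  fixes scale :: "complex \<Rightarrow> 'v::ab_group_add \<Rightarrow> 'v"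
    and act :: "vir \<Rightarrow> 'v \<Rightarrow> 'v"
  assumes "category_W scale act"
    and "locally_finite_on center scale act"
  shows "(\<forall>\<xi>. submodule scale act (gen_eigenspace scale act \<xi>))
    \<and> internal_direct_sum (gen_eigenspace scale act)
    \<and> (fin_gen scale act UNIV \<longrightarrow>
        (\<forall>\<xi>. fin_gen scale act (gen_eigenspace scale act \<xi>)
          \<and> (\<exists>k. filt_eigenspace scale act \<xi> 0 = {0}
               \<and> filt_eigenspace scale act \<xi> k = gen_eigenspace scale act \<xi>
               \<and> (\<forall>i\<le>k. submodule scale act (filt_eigenspace scale act \<xi> i))
               \<and> (\<forall>i<k. filt_eigenspace scale act \<xi> i \<subseteq> filt_eigenspace scale act \<xi> (Suc i)
                     \<and> z_acts_on_quotient_by scale act \<xi>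
                         (filt_eigenspace scale act \<xi> (Suc i)) (filt_eigenspace scale act \<xi> i)))))"
proof -
  interpret vir_module scale act
    using assms(1) by (simp add: category_W_def)
  have ds: "internal_direct_sum (gen_eigenspace scale act)"
    using assms(2) by (rule internal_direct_sum_gen_eigenspace)
  have "filt_eigenspace scale act \<xi> 0 = {0}" for \<xi>
    by (simp add: filt_eigenspace_kernel)
  then have filtration: "\<exists>k. filt_eigenspace scale act \<xi> 0 = {0}
      \<and> filt_eigenspace scale act \<xi> k = gen_eigenspace scale act \<xi>
      \<and> (\<forall>i\<le>k. submodule scale act (filt_eigenspace scale act \<xi> i))
      \<and> (\<forall>i<k. filt_eigenspace scale act \<xi> i \<subseteq> filt_eigenspace scale act \<xi> (Suc i)
            \<and> z_acts_on_quotient_by scale act \<xi>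
                (filt_eigenspace scale act \<xi> (Suc i)) (filt_eigenspace scale act \<xi> i))"
    if "fin_gen scale act UNIV" for \<xi>
    using filtration_exhausts[OF ds that, of \<xi>] submodule_filt_eigenspace filt_eigenspace_mono
      z_acts_on_filtration_quotient by auto
  show ?thesis
  proof (intro conjI allI impI)
    show "submodule scale act (gen_eigenspace scale act \<xi>)" for \<xi>
      by (rule submodule_gen_eigenspace)
    show "internal_direct_sum (gen_eigenspace scale act)" by (rule ds)
    fix \<xi> assume fg: "fin_gen scale act UNIV"
    then show "fin_gen scale act (gen_eigenspace scale act \<xi>)"
      by (rule fin_gen_component[OF ds submodule_gen_eigenspace])
  qed (rule filtration)
qed

end
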